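(* Suppose that $K$ is a centrally symmetric convex disk whose boundary is parameterized by a $C^1$ multi-curve $\sigma$. If two curves $\sigma_{i-1}$ and $\sigma_{i+1}$ move along straight lines during some time interval, then the third curve $\sigma_i$ moves along a hyperbolic arc during that interval, whose asymptotes are the lines determined by $\sigma_{i-1}$ and $\sigma_{i+1}$.
   Context: A centrally symmetric convex disk is a compact convex set $K\subset\mathbb R^2$ with nonempty interior and $K=-K$. A multi-point is a map $\mathbf s:\mathbb Z/6\mathbb Z\to\mathbb R^2$ with $\mathbf s_0+\mathbf s_2+\mathbf s_4=0$, $\mathbf s_{j+3}=-\mathbf s_j$ and $\det(\mathbf s_j,\mathbf s_{j+1})=\sqrt3/2$ for all $j$. A $C^1$ multi-curve is an indexed set of $C^1$ curves $\sigma_j:[0,t_f]\to\mathbb R^2$, $j\in\mathbb Z/6\mathbb Z$, such that $j\mapsto\sigma_j(t)$ is a multi-point for every $t$. The boundary parameterizations considered are by regular curves, traversing the boundary of $K$ counterclockwise. *)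

theory Defs
  imports "HOL-Analysis.Analysis"
begin

definition centrally_symmetric_convex_disk :: "(real^2) set \<Rightarrow> bool" where
  "centrally_symmetric_convex_disk K \<longleftrightarrow>
     compact K \<and> convex K \<and> interior K \<noteq> {} \<and> K = uminus ` K"

text \<open>The vectors are taken as the rows of the matrix; as the determinant is invariant under
  transposition, this agrees with the convention using columns.\<close>
definition det2 :: "real^2 \<Rightarrow> real^2 \<Rightarrow> real" where
  "det2 u v = det (vector [u, v] :: real^2^2)"

text \<open>The numeral type \<open>6\<close> is the ring of integers modulo 6, so index arithmetic is cyclic.\<close>
definition multi_point :: "(6 \<Rightarrow> real^2) \<Rightarrow> bool" where
  "multi_point s \<longleftrightarrow>
     s 0 + s 2 + s 4 = 0 \<and> (\<forall>j. s (j + 3) = - s j) \<and> (\<forall>j. det2 (s j) (s (j + 1)) = sqrt 3 / 2)"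

text \<open>Derivatives are taken within the closed interval, hence are one-sided at its end points
  (unlike in \<open>C1_differentiable_on\<close>, which would require an extension beyond them).\<close>
definition velocity :: "real \<Rightarrow> (real \<Rightarrow> real^2) \<Rightarrow> real \<Rightarrow> real^2" where
  "velocity T c t = vector_derivative c (at t within {0..T})"

definition C1_curve :: "real \<Rightarrow> (real \<Rightarrow> real^2) \<Rightarrow> bool" where
  "C1_curve T c \<longleftrightarrow>
     (\<forall>t\<in>{0..T}. c differentiable (at t within {0..T})) \<and> continuous_on {0..T} (velocity T c)"

definition C1_multi_curve :: "real \<Rightarrow> (6 \<Rightarrow> real \<Rightarrow> real^2) \<Rightarrow> bool" where
  "C1_multi_curve T \<sigma> \<longleftrightarrow>
     0 < T \<and> (\<forall>j. C1_curve T (\<sigma> j)) \<and> (\<forall>t\<in>{0..T}. multi_point (\<lambda>j. \<sigma> j t))"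

text \<open>The six curves together trace out the boundary of \<open>K\<close>, each of them being regular and
  traversing it counterclockwise. For \<open>K\<close> as above the origin is an interior point, so
  counterclockwise means that the polar angle of \<open>\<sigma> j t\<close> increases, i.e. that the angular velocity
  \<open>det (\<sigma> j t, \<sigma>' j t) / |\<sigma> j t|\<^sup>2\<close> is positive. Neither injectivity nor the matching condition
  \<open>\<sigma> j T = \<sigma> (j + 1) 0\<close> is imposed.\<close>
definition parameterizes_boundary ::
  "real \<Rightarrow> (6 \<Rightarrow> real \<Rightarrow> real^2) \<Rightarrow> (real^2) set \<Rightarrow> bool" where
  "parameterizes_boundary T \<sigma> K \<longleftrightarrow>
     (\<Union>j. \<sigma> j ` {0..T}) = frontier K \<and>
     (\<forall>j. \<forall>t\<in>{0..T}. velocity T (\<sigma> j) t \<noteq> 0) \<and>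
     (\<forall>j. \<forall>t\<in>{0..T}. det2 (\<sigma> j t) (velocity T (\<sigma> j) t) > 0)"

definition straight_line :: "(real^2) set \<Rightarrow> bool" where
  "straight_line L \<longleftrightarrow> affine L \<and> aff_dim L = 1"

text \<open>The normal form \<open>x\<^sup>2/a\<^sup>2 - y\<^sup>2/b\<^sup>2 = 1\<close> in some Cartesian coordinate system, with origin \<open>c\<close>
  and orthonormal axes \<open>e\<close>, \<open>f\<close>; the set consists of both branches.\<close>
definition hyperbola :: "(real^2) set \<Rightarrow> bool" where
  "hyperbola H \<longleftrightarrow>
     (\<exists>c e f a b. norm e = 1 \<and> norm f = 1 \<and> e \<bullet> f = 0 \<and> 0 < a \<and> 0 < b \<and>
        H = {p. ((p - c) \<bullet> e)\<^sup>2 / a\<^sup>2 - ((p - c) \<bullet> f)\<^sup>2 / b\<^sup>2 = 1})"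

definition hyperbolic_arc :: "(real^2) set \<Rightarrow> (real^2) set \<Rightarrow> bool" where
  "hyperbolic_arc H A \<longleftrightarrow> hyperbola H \<and> A \<subseteq> H \<and> connected A \<and> (\<exists>p\<in>A. \<exists>q\<in>A. p \<noteq> q)"

text \<open>A line is an asymptote of \<open>H\<close> if the distance to it tends to zero while a point moves
  along \<open>H\<close> to infinity.\<close>
definition asymptote :: "(real^2) set \<Rightarrow> (real^2) set \<Rightarrow> bool" where
  "asymptote H L \<longleftrightarrow> straight_line L \<and>
     (\<exists>p :: real \<Rightarrow> real^2. continuous_on {0..} p \<and> p ` {0..} \<subseteq> H \<and>
        filterlim p at_infinity at_top \<and> ((\<lambda>t. infdist (p t) L) \<longlongrightarrow> 0) at_top)"

end

theory Submission
  imports Defs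
begin

text \<open>
  Put \<open>u = \<sigma> (i - 1)\<close>, \<open>v = \<sigma> (i + 1)\<close>, \<open>w = \<sigma> i\<close>; then \<open>w = u + v\<close> and \<open>det (u, v) = sqrt 3 / 2\<close>. If
  the two lines are \<open>n\<^sub>1 \<bullet> z = m\<^sub>1\<close> and \<open>n\<^sub>2 \<bullet> z = m\<^sub>2\<close>, then by the Binet--Cauchy identity
  \<open>(n\<^sub>1 \<bullet> w - m\<^sub>1) (n\<^sub>2 \<bullet> w - m\<^sub>2) = (n\<^sub>1 \<bullet> v) (n\<^sub>2 \<bullet> u) = m\<^sub>1 m\<^sub>2 - det (n\<^sub>1, n\<^sub>2) sqrt 3 / 2\<close> is constant,
  which is the equation of a hyperbola with the two lines as asymptotes, unless it degenerates.
  Parallel lines would both support \<open>K\<close>, hence be equal or opposite: then \<open>w = u + v\<close> would lie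
  outside \<open>K\<close> or on a line through the origin. If the constant were zero, regularity would force
  \<open>n\<^sub>1 \<bullet> v\<close> to vanish identically, so that \<open>v\<close> would not move.
\<close>

section \<open>Determinants, lines and dual bases in the plane\<close>

lemma inner_vec2: "(x :: real^2) \<bullet> y = x $ 1 * y $ 1 + x $ 2 * y $ 2"
  by (simp add: inner_vec_def sum_2)

lemma det2_eq: "det2 u v = u $ 1 * v $ 2 - u $ 2 * v $ 1"
  by (simp add: det2_def det_2 vector_2)

text \<open>Binet-Cauchy identity in the plane; it converts the fixed determinant of two moving
  points into a relation between their values under two linear forms.\<close>

lemma det2_mult_det2: "det2 m n * det2 u v = (m \<bullet> u) * (n \<bullet> v) - (m \<bullet> v) * (n \<bullet> u)"
  by (simp add: det2_eq inner_vec2 algebra_simps)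

lemma det2_eq_0_iff:
  assumes "n \<noteq> 0"
  shows "det2 m n = 0 \<longleftrightarrow> (\<exists>s. m = s *\<^sub>R n)"
proof
  assume d: "det2 m n = 0"
  have "n $ 1 \<noteq> 0 \<or> n $ 2 \<noteq> 0"
    using assms by (simp add: vec_eq_iff forall_2)
  then show "\<exists>s. m = s *\<^sub>R n"
  proof
    assume "n $ 1 \<noteq> 0"
    with d show ?thesis
      by (intro exI[of _ "m $ 1 / n $ 1"]) (simp add: vec_eq_iff forall_2 det2_eq field_simps)
  next
    assume "n $ 2 \<noteq> 0"
    with d show ?thesis
      by (intro exI[of _ "m $ 2 / n $ 2"]) (simp add: vec_eq_iff forall_2 det2_eq field_simps)
  qed
qed (auto simp: det2_eq)

text \<open>In the plane lines are hyperplanes. The normal is scaled to unit length so that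
  \<open>n \<bullet> z - m\<close> is the signed distance to the line.\<close>

lemma straight_line_hyperplane:
  assumes "straight_line L"
  obtains n m where "norm n = 1" "L = {z. n \<bullet> z = m}"
proof -
  have hull: "affine hull L = L" and "aff_dim L = int (DIM(real^2) - 1)"
    using assms by (simp_all add: straight_line_def)
  from this(2) have "\<exists>a b. a \<noteq> 0 \<and> L = {z. a \<bullet> z = b}"
    unfolding aff_dim_eq_hyperplane hull .
  then obtain a b where ab: "a \<noteq> 0" "L = {z. a \<bullet> z = b}"
    by (elim exE conjE) (rule that)
  show ?thesis
  proof (rule that)
    show "norm (a /\<^sub>R norm a) = 1"
      using ab(1) by simp
    show "L = {z. (a /\<^sub>R norm a) \<bullet> z = b / norm a}"
      using ab by (simp add: divide_inverse mult.commute)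
  qed
qed

lemma straight_line_Collect_inner:
  assumes "n \<noteq> 0"
  shows "straight_line {z :: real^2. n \<bullet> z = m}"
  using assms by (simp add: straight_line_def affine_hyperplane)

lemma infdist_hyperplane:
  fixes n p :: "'a :: euclidean_space"
  assumes "norm n = 1"
  shows "infdist p {z. n \<bullet> z = m} = \<bar>n \<bullet> p - m\<bar>"
proof (rule antisym)
  have nn: "n \<bullet> n = 1"
    using assms by (simp add: norm_eq_1)
  \<comment> \<open>The competitor is the foot of the perpendicular from \<open>p\<close>;
    Cauchy-Schwarz gives the matching lower bound below.\<close>
  have "infdist p {z. n \<bullet> z = m} \<le> dist p (p - (n \<bullet> p - m) *\<^sub>R n)"
    by (rule infdist_le) (simp add: nn inner_diff_right)
  also have "\<dots> = \<bar>n \<bullet> p - m\<bar>"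
    using assms by (simp add: dist_norm)
  finally show "infdist p {z. n \<bullet> z = m} \<le> \<bar>n \<bullet> p - m\<bar>" .
  have "n \<bullet> (m *\<^sub>R n) = m"
    by (simp add: nn)
  then have "{z. n \<bullet> z = m} \<noteq> {}"
    by blast
  then show "\<bar>n \<bullet> p - m\<bar> \<le> infdist p {z. n \<bullet> z = m}"
    unfolding infdist_notempty[OF \<open>{z. n \<bullet> z = m} \<noteq> {}\<close>]
  proof (rule cINF_greatest)
    fix z assume "z \<in> {z. n \<bullet> z = m}"
    then have "n \<bullet> p - m = n \<bullet> (p - z)"
      by (simp add: inner_diff_right)
    also have "\<bar>\<dots>\<bar> \<le> norm n * norm (p - z)"
      by (rule Cauchy_Schwarz_ineq2)
    finally show "\<bar>n \<bullet> p - m\<bar> \<le> dist p z"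
      by (simp add: assms dist_norm)
  qed
qed

text \<open>Cramer's rule gives the dual basis. The first expansion recovers a point from the values
  of the two forms; the second resolves the normal of an arbitrary line along
  \<open>n\<^sub>1\<close> and \<open>n\<^sub>2\<close>.\<close>

lemma dual_basis2:
  fixes n\<^sub>1 n\<^sub>2 :: "real^2"
  assumes "det2 n\<^sub>1 n\<^sub>2 \<noteq> 0"
  obtains e\<^sub>1 e\<^sub>2 where "n\<^sub>1 \<bullet> e\<^sub>1 = 1" "n\<^sub>2 \<bullet> e\<^sub>1 = 0" "n\<^sub>1 \<bullet> e\<^sub>2 = 0" "n\<^sub>2 \<bullet> e\<^sub>2 = 1"
    "\<And>z. z = (n\<^sub>1 \<bullet> z) *\<^sub>R e\<^sub>1 + (n\<^sub>2 \<bullet> z) *\<^sub>R e\<^sub>2"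
    "\<And>z. z = (z \<bullet> e\<^sub>1) *\<^sub>R n\<^sub>1 + (z \<bullet> e\<^sub>2) *\<^sub>R n\<^sub>2"
proof
  let ?D = "det2 n\<^sub>1 n\<^sub>2"
  define e\<^sub>1 :: "real^2" where "e\<^sub>1 = vector [n\<^sub>2 $ 2 / ?D, - n\<^sub>2 $ 1 / ?D]"
  define e\<^sub>2 :: "real^2" where "e\<^sub>2 = vector [- n\<^sub>1 $ 2 / ?D, n\<^sub>1 $ 1 / ?D]"
  have D: "n\<^sub>1 $ 1 * n\<^sub>2 $ 2 - n\<^sub>1 $ 2 * n\<^sub>2 $ 1 \<noteq> 0"
    using assms by (simp add: det2_eq)
  have comps: "e\<^sub>1 $ 1 = n\<^sub>2 $ 2 / ?D" "e\<^sub>1 $ 2 = - n\<^sub>2 $ 1 / ?D" "e\<^sub>2 $ 1 = - n\<^sub>1 $ 2 / ?D" "e\<^sub>2 $ 2 = n\<^sub>1 $ 1 / ?D"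
    by (simp_all add: e\<^sub>1_def e\<^sub>2_def vector_2)
  note defs = inner_vec2 comps det2_eq vec_eq_iff forall_2 vector_add_component vector_scaleR_component
  show "n\<^sub>1 \<bullet> e\<^sub>1 = 1" "n\<^sub>2 \<bullet> e\<^sub>1 = 0" "n\<^sub>1 \<bullet> e\<^sub>2 = 0" "n\<^sub>2 \<bullet> e\<^sub>2 = 1"
    using assms by (simp_all add: inner_vec2 comps field_simps) (simp_all add: det2_eq algebra_simps)
  show "z = (n\<^sub>1 \<bullet> z) *\<^sub>R e\<^sub>1 + (n\<^sub>2 \<bullet> z) *\<^sub>R e\<^sub>2" for z
    using D unfolding defs by (auto simp: divide_simps; simp add: algebra_simps)
  show "z = (z \<bullet> e\<^sub>1) *\<^sub>R n\<^sub>1 + (z \<bullet> e\<^sub>2) *\<^sub>R n\<^sub>2" for z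
    using D unfolding defs by (auto simp: divide_simps; simp add: algebra_simps)
qed

section \<open>Algebra of multi-points and parallel vectors\<close>

text \<open>Since \<open>s 4 = - s 1\<close>, the zero sum reads \<open>s 1 = s 0 + s 2\<close>; the
  other five indices give the same relation up to sign and rearrangement.\<close>

lemma multi_point_add:
  assumes "multi_point s"
  shows "s i = s (i - 1) + s (i + 1)"
proof -
  have a: "s (j + 3) = - s j" for j
    using assms by (simp add: multi_point_def)
  have z: "s 0 + s 2 + s 4 = 0"
    using assms by (simp add: multi_point_def)
  have e: "s 3 = - s 0" "s 4 = - s 1" "s 5 = - s 2"
    using a[of 0] a[of 1] a[of 2] by simp_all
  show ?thesis
  proof (cases i)
    case (of_int k)
    then have "k = 0 \<or> k = 1 \<or> k = 2 \<or> k = 3 \<or> k = 4 \<or> k = 5"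
      by simp presburger
    \<comment> \<open>These indices arise cyclically as the predecessor of 0 and the successor of
      5.\<close>
    moreover have "s (- 1) = s 5" "s 6 = s 0"
      by (rule arg_cong[of _ _ s], simp)+
    ultimately show ?thesis
      using of_int(1) z by (auto simp: e algebra_simps)
  qed
qed

text \<open>Substituting \<open>s i = s (i - 1) + s (i + 1)\<close> into the determinant of the
  neighbours \<open>s (i - 1)\<close> and \<open>s i\<close> leaves this one, as a vector has
  determinant zero with itself.\<close>

lemma det2_skip:
  assumes "multi_point s"
  shows "det2 (s (i - 1)) (s (i + 1)) = sqrt 3 / 2"
proof -
  have "det2 (s (i - 1)) (s (i - 1 + 1)) = sqrt 3 / 2"
    using assms unfolding multi_point_def by blast
  then show ?thesis
    unfolding diff_add_cancel by (subst (asm) multi_point_add[OF assms, of i]) (simp add: det2_eq algebra_simps)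
qed

text \<open>By Cramer's rule, each coordinate of \<open>n\<close> times the determinant is a
  combination of \<open>n \<bullet> u\<close> and \<open>n \<bullet> v\<close>. This serves both for
  position against velocity and for normals orthogonal to a common velocity.\<close>

lemma orthogonal_imp_det2_eq_0:
  assumes "n \<noteq> 0" "n \<bullet> u = 0" "n \<bullet> v = 0"
  shows "det2 u v = 0"
proof -
  have "n $ 1 * det2 u v = (n \<bullet> u) * v $ 2 - (n \<bullet> v) * u $ 2"
    "n $ 2 * det2 u v = (n \<bullet> v) * u $ 1 - (n \<bullet> u) * v $ 1"
    by (simp_all add: det2_eq inner_vec2 algebra_simps)
  moreover have "n $ 1 \<noteq> 0 \<or> n $ 2 \<noteq> 0"
    using assms(1) by (simp add: vec_eq_iff forall_2)
  ultimately show ?thesis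
    using assms by auto
qed

section \<open>Hyperbolas as level sets of a product of two affine forms\<close>

text \<open>With \<open>A\<close> and \<open>B\<close> the two factors, \<open>4 * A * B\<close> is
  the square of \<open>A + B\<close> minus the square of \<open>A - B\<close>. Because the normals
  are unit vectors, their sum and difference are orthogonal and give the axes.\<close>

lemma hyperbola_product_pos:
  assumes "norm n\<^sub>1 = 1" "norm n\<^sub>2 = 1" "det2 n\<^sub>1 n\<^sub>2 \<noteq> 0" "0 < k"
  shows "hyperbola {z. (n\<^sub>1 \<bullet> z - m\<^sub>1) * (n\<^sub>2 \<bullet> z - m\<^sub>2) = k}"
proof -
  obtain e\<^sub>1 e\<^sub>2 where e: "n\<^sub>1 \<bullet> e\<^sub>1 = 1" "n\<^sub>2 \<bullet> e\<^sub>1 = 0" "n\<^sub>1 \<bullet> e\<^sub>2 = 0" "n\<^sub>2 \<bullet> e\<^sub>2 = 1"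
    using dual_basis2[OF assms(3)] by metis
  \<comment> \<open>The centre is the intersection of the two lines.\<close>
  define q where "q = m\<^sub>1 *\<^sub>R e\<^sub>1 + m\<^sub>2 *\<^sub>R e\<^sub>2"
  have q: "n\<^sub>1 \<bullet> q = m\<^sub>1" "n\<^sub>2 \<bullet> q = m\<^sub>2"
    by (simp_all add: q_def inner_add_right e)
  define N where "N = norm (n\<^sub>1 + n\<^sub>2)"
  define M where "M = norm (n\<^sub>1 - n\<^sub>2)"
  have "n\<^sub>1 + n\<^sub>2 \<noteq> 0" "n\<^sub>1 - n\<^sub>2 \<noteq> 0"
    using assms(3) by (auto simp: det2_eq add_eq_0_iff2)
  then have NM: "0 < N" "0 < M"
    by (simp_all add: N_def M_def)
  show ?thesis
    unfolding hyperbola_def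
  proof (intro exI conjI)
    show "norm ((n\<^sub>1 + n\<^sub>2) /\<^sub>R N) = 1" "norm ((n\<^sub>1 - n\<^sub>2) /\<^sub>R M) = 1"
      using NM by (simp_all add: N_def M_def)
    show "((n\<^sub>1 + n\<^sub>2) /\<^sub>R N) \<bullet> ((n\<^sub>1 - n\<^sub>2) /\<^sub>R M) = 0"
      using assms(1,2) by (simp add: inner_diff_right inner_diff_left inner_add_left inner_add_right inner_commute norm_eq_1)
    show "0 < 2 * sqrt k / N" "0 < 2 * sqrt k / M"
      using NM assms(4) by simp_all
    have "((z - q) \<bullet> ((n\<^sub>1 + n\<^sub>2) /\<^sub>R N))\<^sup>2 / (2 * sqrt k / N)\<^sup>2 -
        ((z - q) \<bullet> ((n\<^sub>1 - n\<^sub>2) /\<^sub>R M))\<^sup>2 / (2 * sqrt k / M)\<^sup>2 =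
        (n\<^sub>1 \<bullet> z - m\<^sub>1) * (n\<^sub>2 \<bullet> z - m\<^sub>2) / k" (is "?l z = _") for z
    proof -
      define A where "A = n\<^sub>1 \<bullet> z - m\<^sub>1"
      define B where "B = n\<^sub>2 \<bullet> z - m\<^sub>2"
      have AB: "n\<^sub>1 \<bullet> (z - q) = A" "n\<^sub>2 \<bullet> (z - q) = B"
        by (simp_all add: A_def B_def q inner_diff_right)
      have 1: "(z - q) \<bullet> ((n\<^sub>1 + n\<^sub>2) /\<^sub>R N) = (A + B) / N"
        by (simp add: inner_commute[of "z - q"] inner_add_left AB divide_inverse)
      have 2: "(z - q) \<bullet> ((n\<^sub>1 - n\<^sub>2) /\<^sub>R M) = (A - B) / M"
        by (simp add: inner_commute[of "z - q"] inner_diff_left[of n\<^sub>1 n\<^sub>2] AB divide_inverse del: inner_diff_right)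
      have "?l z = (A + B)\<^sup>2 / (4 * k) - (A - B)\<^sup>2 / (4 * k)"
        using NM assms(4) unfolding 1 2 by (simp add: power_divide power_mult_distrib)
      also have "\<dots> = A * B / k"
        using assms(4) by (simp add: field_simps power2_eq_square)
      finally show ?thesis
        by (simp add: A_def B_def)
    qed
    then show "{z. (n\<^sub>1 \<bullet> z - m\<^sub>1) * (n\<^sub>2 \<bullet> z - m\<^sub>2) = k} = {z. ?l z = 1}"
      using assms(4) by auto
  qed
qed

text \<open>Reversing the sign of \<open>n\<^sub>2\<close> and \<open>m\<^sub>2\<close> describes
  the same set with \<open>- k\<close> in place of \<open>k\<close>, which reduces to the positive
  case.\<close>

lemma hyperbola_product:
  assumes "norm n\<^sub>1 = 1" "norm n\<^sub>2 = 1" "det2 n\<^sub>1 n\<^sub>2 \<noteq> 0" "k \<noteq> 0"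
  shows "hyperbola {z. (n\<^sub>1 \<bullet> z - m\<^sub>1) * (n\<^sub>2 \<bullet> z - m\<^sub>2) = k}"
proof (cases "0 < k")
  case True
  then show ?thesis
    using hyperbola_product_pos assms by blast
next
  case False
  have "det2 n\<^sub>1 (- n\<^sub>2) = - det2 n\<^sub>1 n\<^sub>2"
    by (simp add: det2_eq)
  then have "hyperbola {z. (n\<^sub>1 \<bullet> z - m\<^sub>1) * (- n\<^sub>2 \<bullet> z - - m\<^sub>2) = - k}"
    using False assms by (intro hyperbola_product_pos) auto
  moreover have "(n\<^sub>1 \<bullet> z - m\<^sub>1) * (- n\<^sub>2 \<bullet> z - - m\<^sub>2) = - k \<longleftrightarrow>
      (n\<^sub>1 \<bullet> z - m\<^sub>1) * (n\<^sub>2 \<bullet> z - m\<^sub>2) = k" for z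
    by (auto simp: algebra_simps)
  ultimately show ?thesis
    by simp
qed

section \<open>Determination of the asymptotes\<close>

lemma asymptote_product:
  assumes "norm n\<^sub>1 = 1" "norm n\<^sub>2 = 1" "det2 n\<^sub>1 n\<^sub>2 \<noteq> 0"
  shows "asymptote {z. (n\<^sub>1 \<bullet> z - m\<^sub>1) * (n\<^sub>2 \<bullet> z - m\<^sub>2) = k} {z. n\<^sub>1 \<bullet> z = m\<^sub>1}"
proof -
  obtain e\<^sub>1 e\<^sub>2 where e: "n\<^sub>1 \<bullet> e\<^sub>1 = 1" "n\<^sub>2 \<bullet> e\<^sub>1 = 0" "n\<^sub>1 \<bullet> e\<^sub>2 = 0" "n\<^sub>2 \<bullet> e\<^sub>2 = 1"
    using dual_basis2[OF assms(3)] by metis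
  \<comment> \<open>The second factor is given the value \<open>1 + t\<close>, which forces
    \<open>k / (1 + t)\<close> for the first; the shift by 1 keeps the denominator positive on the
    whole half-line.\<close>
  define p where "p = (\<lambda>t::real. (m\<^sub>1 + k / (1 + t)) *\<^sub>R e\<^sub>1 + (m\<^sub>2 + (1 + t)) *\<^sub>R e\<^sub>2)"
  have p: "n\<^sub>1 \<bullet> p t = m\<^sub>1 + k / (1 + t)" "n\<^sub>2 \<bullet> p t = m\<^sub>2 + (1 + t)" for t
    by (simp_all add: p_def inner_add_right e)
  have small: "((\<lambda>t. k / (1 + t)) \<longlongrightarrow> 0) at_top"
    by (intro tendsto_divide_0[OF tendsto_const] filterlim_at_top_imp_at_infinity
        filterlim_tendsto_add_at_top[OF tendsto_const filterlim_ident])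
  have "continuous_on {0..} p"
    unfolding p_def by (intro continuous_intros) auto
  moreover have "p ` {0..} \<subseteq> {z. (n\<^sub>1 \<bullet> z - m\<^sub>1) * (n\<^sub>2 \<bullet> z - m\<^sub>2) = k}"
    by (auto simp: p)
  moreover have "filterlim p at_infinity at_top"
  proof -
    have "filterlim (\<lambda>t. n\<^sub>2 \<bullet> p t) at_top at_top"
      unfolding p by (intro filterlim_tendsto_add_at_top[OF tendsto_const] filterlim_ident)
    then have "filterlim (\<lambda>t. norm (p t)) at_top at_top"
    proof (rule filterlim_at_top_mono)
      have "n\<^sub>2 \<bullet> p t \<le> norm (p t)" for t
        using norm_cauchy_schwarz[of n\<^sub>2 "p t"] assms(2) by simp
      then show "\<forall>\<^sub>F t in at_top. n\<^sub>2 \<bullet> p t \<le> norm (p t)"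
        by simp
    qed
    then show ?thesis
      by (simp add: filterlim_at_infinity_conv_norm_at_top)
  qed
  moreover have "((\<lambda>t. infdist (p t) {z. n\<^sub>1 \<bullet> z = m\<^sub>1}) \<longlongrightarrow> 0) at_top"
    using small by (simp add: infdist_hyperplane[OF assms(1)] p tendsto_rabs_zero_iff del: abs_divide)
  moreover have "straight_line {z. n\<^sub>1 \<bullet> z = m\<^sub>1}"
    using assms(1) by (intro straight_line_Collect_inner) auto
  ultimately show ?thesis
    unfolding asymptote_def by blast
qed

text \<open>A candidate line parallel to the first one has normal
  \<open>\<alpha> *\<^sub>R n\<^sub>1\<close>. Were its offset wrong, the first factor would have a
  nonzero limit, so the second would converge too, and \<open>p\<close> could not go to
  infinity.\<close>

lemma asymptote_parallel_imp_eq: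
  assumes "det2 n\<^sub>1 n\<^sub>2 \<noteq> 0" "k \<noteq> 0" "\<alpha> \<noteq> 0"
    and p: "filterlim p at_infinity at_top"
    and H: "\<And>t. 0 \<le> t \<Longrightarrow> (n\<^sub>1 \<bullet> p t - m\<^sub>1) * (n\<^sub>2 \<bullet> p t - m\<^sub>2) = k"
    and lim: "((\<lambda>t::real. \<alpha> * (n\<^sub>1 \<bullet> p t) - m) \<longlongrightarrow> 0) at_top"
  shows "m = \<alpha> * m\<^sub>1"
proof (rule ccontr)
  assume ne: "m \<noteq> \<alpha> * m\<^sub>1"
  obtain e\<^sub>1 e\<^sub>2 where e: "\<And>z. z = (n\<^sub>1 \<bullet> z) *\<^sub>R e\<^sub>1 + (n\<^sub>2 \<bullet> z) *\<^sub>R e\<^sub>2"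
    using dual_basis2[OF assms(1)] by metis
  have "((\<lambda>t. (\<alpha> * (n\<^sub>1 \<bullet> p t) - m + m) / \<alpha>) \<longlongrightarrow> (0 + m) / \<alpha>) at_top"
    by (intro tendsto_intros lim assms)
  then have 1: "((\<lambda>t. n\<^sub>1 \<bullet> p t) \<longlongrightarrow> m / \<alpha>) at_top"
    using assms by simp
  have "m / \<alpha> - m\<^sub>1 \<noteq> 0"
    using ne assms(3) by (simp add: field_simps)
  then have "((\<lambda>t. k / (n\<^sub>1 \<bullet> p t - m\<^sub>1) + m\<^sub>2) \<longlongrightarrow> k / (m / \<alpha> - m\<^sub>1) + m\<^sub>2) at_top"
    by (intro tendsto_intros 1)
  moreover have "\<forall>\<^sub>F t in at_top. k / (n\<^sub>1 \<bullet> p t - m\<^sub>1) + m\<^sub>2 = n\<^sub>2 \<bullet> p t"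
    using eventually_ge_at_top[of 0]
  proof eventually_elim
    case (elim t)
    then have "n\<^sub>1 \<bullet> p t - m\<^sub>1 \<noteq> 0"
      using H[OF elim] assms(2) by auto
    then have "k / (n\<^sub>1 \<bullet> p t - m\<^sub>1) = n\<^sub>2 \<bullet> p t - m\<^sub>2"
      unfolding H[OF elim, symmetric] by (rule nonzero_mult_div_cancel_left)
    then show ?case
      by simp
  qed
  ultimately have 2: "((\<lambda>t. n\<^sub>2 \<bullet> p t) \<longlongrightarrow> k / (m / \<alpha> - m\<^sub>1) + m\<^sub>2) at_top"
    by (rule Lim_transform_eventually)
  have "((\<lambda>t. (n\<^sub>1 \<bullet> p t) *\<^sub>R e\<^sub>1 + (n\<^sub>2 \<bullet> p t) *\<^sub>R e\<^sub>2) \<longlongrightarrow>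
      (m / \<alpha>) *\<^sub>R e\<^sub>1 + (k / (m / \<alpha> - m\<^sub>1) + m\<^sub>2) *\<^sub>R e\<^sub>2) at_top"
    by (intro tendsto_intros 1 2)
  then show False
    using not_tendsto_and_filterlim_at_infinity[OF _ _ p] by (auto simp flip: e)
qed

text \<open>The normal of a candidate line is resolved along \<open>n\<^sub>1\<close> and
  \<open>n\<^sub>2\<close>. A vanishing coefficient means that the line is parallel to one of the
  two lines; if neither vanishes, approaching the line keeps \<open>p\<close> bounded.\<close>

lemma asymptote_product_cases:
  assumes "det2 n\<^sub>1 n\<^sub>2 \<noteq> 0" "k \<noteq> 0"
    and "asymptote {z. (n\<^sub>1 \<bullet> z - m\<^sub>1) * (n\<^sub>2 \<bullet> z - m\<^sub>2) = k} L"
  shows "L = {z. n\<^sub>1 \<bullet> z = m\<^sub>1} \<or> L = {z. n\<^sub>2 \<bullet> z = m\<^sub>2}"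
proof -
  obtain p where L: "straight_line L"
    and pH: "\<And>t. 0 \<le> t \<Longrightarrow> (n\<^sub>1 \<bullet> p t - m\<^sub>1) * (n\<^sub>2 \<bullet> p t - m\<^sub>2) = k"
    and pinf: "filterlim p at_infinity at_top"
    and plim: "((\<lambda>t::real. infdist (p t) L) \<longlongrightarrow> 0) at_top"
    using assms(3) unfolding asymptote_def by fastforce
  obtain n m where nm: "norm n = 1" "L = {z. n \<bullet> z = m}"
    using straight_line_hyperplane[OF L] by metis
  obtain e\<^sub>1 e\<^sub>2 where e: "\<And>z. z = (n\<^sub>1 \<bullet> z) *\<^sub>R e\<^sub>1 + (n\<^sub>2 \<bullet> z) *\<^sub>R e\<^sub>2"
    "\<And>z. z = (z \<bullet> e\<^sub>1) *\<^sub>R n\<^sub>1 + (z \<bullet> e\<^sub>2) *\<^sub>R n\<^sub>2"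
    using dual_basis2[OF assms(1)] by metis
  define \<alpha> \<beta> where "\<alpha> = n \<bullet> e\<^sub>1" and "\<beta> = n \<bullet> e\<^sub>2"
  have n: "n = \<alpha> *\<^sub>R n\<^sub>1 + \<beta> *\<^sub>R n\<^sub>2"
    using e(2)[of n] by (simp add: \<alpha>_def \<beta>_def)
  have lim: "((\<lambda>t. \<alpha> * (n\<^sub>1 \<bullet> p t) + \<beta> * (n\<^sub>2 \<bullet> p t) - m) \<longlongrightarrow> 0) at_top"
    using plim unfolding nm(2) infdist_hyperplane[OF nm(1)] tendsto_rabs_zero_iff
    by (simp add: n inner_add_left)
  have "\<alpha> \<noteq> 0 \<or> \<beta> \<noteq> 0"
    using n nm(1) by auto
  then consider "\<alpha> \<noteq> 0" "\<beta> = 0" | "\<alpha> = 0" "\<beta> \<noteq> 0" | "\<alpha> \<noteq> 0" "\<beta> \<noteq> 0"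
    by blast
  then show ?thesis
  proof cases
    case 1
    then have "m = \<alpha> * m\<^sub>1"
      using lim by (intro asymptote_parallel_imp_eq[OF assms(1,2) _ pinf pH]) auto
    then show ?thesis
      using 1 by (simp add: nm(2) n)
  next
    case 2
    have "det2 n\<^sub>2 n\<^sub>1 \<noteq> 0"
      using assms(1) by (simp add: det2_eq algebra_simps)
    then have "m = \<beta> * m\<^sub>2"
      using lim 2 pH
      by (intro asymptote_parallel_imp_eq[OF _ assms(2) _ pinf, of n\<^sub>2 n\<^sub>1 \<beta> m\<^sub>2 m\<^sub>1])
         (auto simp: mult.commute)
    then show ?thesis
      using 2 by (simp add: nm(2) n)
  next
    case 3
    define A where "A t = \<alpha> * (n\<^sub>1 \<bullet> p t - m\<^sub>1)" for t
    define B where "B t = \<beta> * (n\<^sub>2 \<bullet> p t - m\<^sub>2)" for t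
    \<comment> \<open>\<open>C\<close> bounds \<open>A t + B t\<close> once \<open>p t\<close> is
      within distance 1 of the line. As the product \<open>A t * B t\<close> is constant, the sum of
      the squares is then bounded as well, and \<open>E\<close> bounds each of \<open>A t\<close>
      and \<open>B t\<close>.\<close>
    define C where "C = 1 + \<bar>m - \<alpha> * m\<^sub>1 - \<beta> * m\<^sub>2\<bar>"
    define E where "E = sqrt (C\<^sup>2 + 2 * \<bar>\<alpha> * \<beta> * k\<bar>)"
    have bound: "\<bar>x\<bar> \<le> E / \<bar>\<gamma>\<bar> + \<bar>y\<bar>" if "\<bar>\<gamma> * (x - y)\<bar> \<le> E" "\<gamma> \<noteq> 0" for \<gamma> x y
    proof -
      have "\<bar>x - y\<bar> \<le> E / \<bar>\<gamma>\<bar>"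
        using that unfolding abs_mult by (simp add: pos_le_divide_eq mult.commute)
      then show ?thesis
        by linarith
    qed
    have "\<forall>\<^sub>F t in at_top. \<bar>\<alpha> * (n\<^sub>1 \<bullet> p t) + \<beta> * (n\<^sub>2 \<bullet> p t) - m\<bar> < 1"
      using tendstoD[OF lim, of 1] by simp
    then have "\<forall>\<^sub>F t in at_top. norm (p t) \<le>
        (E / \<bar>\<alpha>\<bar> + \<bar>m\<^sub>1\<bar>) * norm e\<^sub>1 + (E / \<bar>\<beta>\<bar> + \<bar>m\<^sub>2\<bar>) * norm e\<^sub>2"
      using eventually_ge_at_top[of 0]
    proof eventually_elim
      case (elim t)
      have "\<bar>A t + B t\<bar> \<le> C"
        using elim(1) by (simp add: A_def B_def C_def algebra_simps)
      then have C: "(A t + B t)\<^sup>2 \<le> C\<^sup>2"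
        by (metis abs_ge_zero power2_abs power_mono)
      have "A t * B t = \<alpha> * \<beta> * k"
        using pH[OF elim(2)] by (simp add: A_def B_def)
      then have "(A t)\<^sup>2 + (B t)\<^sup>2 = (A t + B t)\<^sup>2 - 2 * (\<alpha> * \<beta> * k)"
        by (simp add: power2_sum)
      with C have sq: "(A t)\<^sup>2 + (B t)\<^sup>2 \<le> C\<^sup>2 + 2 * \<bar>\<alpha> * \<beta> * k\<bar>"
        by linarith
      have "\<bar>A t\<bar> \<le> E"
        unfolding E_def by (rule real_le_rsqrt) (use sq in \<open>simp; smt (verit) zero_le_power2\<close>)
      then have 1: "\<bar>n\<^sub>1 \<bullet> p t\<bar> \<le> E / \<bar>\<alpha>\<bar> + \<bar>m\<^sub>1\<bar>"
        using bound[of \<alpha> "n\<^sub>1 \<bullet> p t" m\<^sub>1] 3 by (simp add: A_def)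
      have "\<bar>B t\<bar> \<le> E"
        unfolding E_def by (rule real_le_rsqrt) (use sq in \<open>simp; smt (verit) zero_le_power2\<close>)
      then have 2: "\<bar>n\<^sub>2 \<bullet> p t\<bar> \<le> E / \<bar>\<beta>\<bar> + \<bar>m\<^sub>2\<bar>"
        using bound[of \<beta> "n\<^sub>2 \<bullet> p t" m\<^sub>2] 3 by (simp add: B_def)
      have "norm (p t) \<le> \<bar>n\<^sub>1 \<bullet> p t\<bar> * norm e\<^sub>1 + \<bar>n\<^sub>2 \<bullet> p t\<bar> * norm e\<^sub>2"
        by (subst e(1)[of "p t"]) (rule norm_triangle_le, simp)
      also have "\<dots> \<le> (E / \<bar>\<alpha>\<bar> + \<bar>m\<^sub>1\<bar>) * norm e\<^sub>1 + (E / \<bar>\<beta>\<bar> + \<bar>m\<^sub>2\<bar>) * norm e\<^sub>2"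
        by (intro add_mono mult_right_mono 1 2) auto
      finally show ?case .
    qed
    moreover have "\<forall>\<^sub>F t in at_top. (E / \<bar>\<alpha>\<bar> + \<bar>m\<^sub>1\<bar>) * norm e\<^sub>1 + (E / \<bar>\<beta>\<bar> + \<bar>m\<^sub>2\<bar>) * norm e\<^sub>2 < norm (p t)"
      using pinf unfolding filterlim_at_infinity_conv_norm_at_top filterlim_at_top_dense by blast
    ultimately have "\<forall>\<^sub>F t :: real in at_top. False"
      by eventually_elim simp
    then show ?thesis
      by simp
  qed
qed

section \<open>Tangents and supporting lines of the disk\<close>

lemma inner_has_real_derivative:
  assumes "(c has_vector_derivative v) (at t)"
  shows "((\<lambda>s. n \<bullet> c s) has_real_derivative n \<bullet> v) (at t)"
  unfolding has_real_derivative_iff_has_vector_derivative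
  by (rule bounded_linear.has_vector_derivative[OF bounded_linear_inner_right assms])

text \<open>Fermat's theorem along a direction \<open>n\<close>. The non-strict inequality admits a
  constant \<open>n \<bullet> c s\<close>, so the lemma also differentiates the equation of a
  line.\<close>

lemma inner_local_max_derivative:
  assumes "(c has_vector_derivative v) (at t)" "open S" "t \<in> S"
    and "\<And>s. s \<in> S \<Longrightarrow> n \<bullet> c s \<le> n \<bullet> c t"
  shows "n \<bullet> v = 0"
proof -
  obtain d where "0 < d" "ball t d \<subseteq> S"
    using assms(2,3) openE by blast
  then show ?thesis
    using DERIV_local_max[OF inner_has_real_derivative[OF assms(1)], of d] assms(4)
    by (force simp: dist_real_def)
qed

text \<open>A differentiable boundary curve with nonzero velocity is tangent to any supporting line
  at its point, so \<open>n\<close> is a multiple of the supporting normal. Central symmetry turns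
  the one-sided support inequality into a bound by a strip.\<close>

lemma symmetric_convex_disk_width:
  assumes K: "centrally_symmetric_convex_disk K"
    and c: "(c has_vector_derivative v) (at t)" "open S" "t \<in> S" "c ` S \<subseteq> frontier K"
    and "v \<noteq> 0" "n \<noteq> 0" "n \<bullet> v = 0" "z \<in> K"
  shows "\<bar>n \<bullet> z\<bar> \<le> \<bar>n \<bullet> c t\<bar>"
proof -
  have cK: "closed K" "convex K" "interior K \<noteq> {}" and sym: "K = uminus ` K"
    using K unfolding centrally_symmetric_convex_disk_def by (blast intro: compact_imp_closed)+
  have fK: "c s \<in> K" if "s \<in> S" for s
    using that c(4) cK(1) frontier_subset_closed by blast
  have "c t \<notin> rel_interior K"
    using c(3,4) cK(3) by (auto simp: rel_interior_nonempty_interior frontier_def)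
  then obtain a where a: "a \<noteq> 0" "\<And>y. y \<in> K \<Longrightarrow> a \<bullet> c t \<le> a \<bullet> y"
    using supporting_hyperplane_rel_boundary[OF cK(2) fK[OF c(3)]] by metis
  \<comment> \<open>The curve stays in \<open>K\<close>, so \<open>a \<bullet> c s\<close> is
    minimal at \<open>t\<close>; the sign turns this into a maximum.\<close>
  have "- a \<bullet> v = 0"
    by (rule inner_local_max_derivative[OF c(1-3)]) (use a fK in auto)
  then have "det2 a n = 0"
    using assms(6,8) by (intro orthogonal_imp_det2_eq_0[of v]) (auto simp: inner_commute)
  then obtain s where s: "a = s *\<^sub>R n"
    using det2_eq_0_iff[OF assms(7)] by blast
  with a(1) have "s \<noteq> 0"
    by auto
  have "- z \<in> K"
    using imageI[OF assms(9), of uminus] sym by metis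
  then have "\<bar>a \<bullet> z\<bar> \<le> \<bar>a \<bullet> c t\<bar>"
    using a(2)[of z] a(2)[of "- z"] assms(9) by auto
  then show ?thesis
    using \<open>s \<noteq> 0\<close> by (simp add: s abs_mult)
qed

text \<open>At interior times the derivative within the interval is the ordinary two-sided one, as
  needed for Fermat's theorem and the product rule.\<close>

lemma C1_curve_has_vector_derivative:
  assumes "C1_curve T c" "t \<in> interior {0..T}"
  shows "(c has_vector_derivative velocity T c t) (at t)"
proof -
  have "t \<in> {0..T}"
    using assms(2) interior_subset by blast
  then have "(c has_vector_derivative velocity T c t) (at t within {0..T})"
    using assms(1) unfolding C1_curve_def velocity_def by (blast intro: vector_derivative_works[THEN iffD1])
  then show ?thesis
    unfolding at_within_interior[OF assms(2)] .
qed

section \<open>The path of the sum of two points moving on lines\<close>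

theorem lemma3p1p8:
  fixes K :: "(real^2) set" and \<sigma> :: "6 \<Rightarrow> real \<Rightarrow> real^2" and t\<^sub>f :: real
    and i :: 6 and I :: "real set" and L\<^sub>1 L\<^sub>2 :: "(real^2) set"
  assumes "centrally_symmetric_convex_disk K"
    and "C1_multi_curve t\<^sub>f \<sigma>"
    and "parameterizes_boundary t\<^sub>f \<sigma> K"
    and "is_interval I" and "interior I \<noteq> {}" and "I \<subseteq> {0..t\<^sub>f}"
    and "straight_line L\<^sub>1" and "\<sigma> (i - 1) ` I \<subseteq> L\<^sub>1"
    and "straight_line L\<^sub>2" and "\<sigma> (i + 1) ` I \<subseteq> L\<^sub>2"
  shows "\<exists>H. hyperbolic_arc H (\<sigma> i ` I) \<and> L\<^sub>1 \<noteq> L\<^sub>2 \<and> {L. asymptote H L} = {L\<^sub>1, L\<^sub>2}"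
proof -
  \<comment> \<open>Arguments with derivatives take place on the open set \<open>S\<close>; the
    algebraic identities hold on all of \<open>I\<close>, end points included.\<close>
  define S where "S = interior I"
  have S: "open S" "S \<subseteq> I" "S \<subseteq> {0..t\<^sub>f}" "S \<subseteq> interior {0..t\<^sub>f}"
    using assms(6) interior_subset[of I] interior_mono[OF assms(6)] by (auto simp: S_def)
  obtain t\<^sub>0 where t0: "t\<^sub>0 \<in> S"
    using assms(5) by (auto simp: S_def)
  define u where "u = \<sigma> (i - 1)"
  define v where "v = \<sigma> (i + 1)"
  define w where "w = \<sigma> i"
  define u' where "u' = velocity t\<^sub>f u"
  define v' where "v' = velocity t\<^sub>f v"
  define w' where "w' = velocity t\<^sub>f w"
  have mp: "multi_point (\<lambda>j. \<sigma> j t)" if "t \<in> I" for t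
    using assms(2,6) that by (auto simp: C1_multi_curve_def)
  have w: "w t = u t + v t" and uv: "det2 (u t) (v t) = sqrt 3 / 2" if "t \<in> I" for t
    using multi_point_add[OF mp[OF that]] det2_skip[OF mp[OF that]] unfolding u_def v_def w_def by blast+
  have der: "(\<sigma> j has_vector_derivative velocity t\<^sub>f (\<sigma> j) t) (at t)" if "t \<in> S" for j t
    using assms(2) S(4) that by (intro C1_curve_has_vector_derivative) (auto simp: C1_multi_curve_def)
  note du = der[of _ "i - 1", folded u_def, folded u'_def] and dv = der[of _ "i + 1", folded v_def, folded v'_def]
    and dw = der[of _ i, folded w_def, folded w'_def]
  have reg: "velocity t\<^sub>f (\<sigma> j) t \<noteq> 0" "det2 (\<sigma> j t) (velocity t\<^sub>f (\<sigma> j) t) > 0" if "t \<in> S" for j t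
    using assms(3) S(3) that by (auto simp: parameterizes_boundary_def)
  note ru = reg[of _ "i - 1", folded u_def, folded u'_def] and rv = reg[of _ "i + 1", folded v_def, folded v'_def]
    and rw = reg[of _ i, folded w_def, folded w'_def]
  have "\<sigma> j ` S \<subseteq> frontier K" for j
    using assms(3) S(3) by (fastforce simp: parameterizes_boundary_def)
  then have fr: "u ` S \<subseteq> frontier K" "v ` S \<subseteq> frontier K" "w ` S \<subseteq> frontier K"
    by (simp_all add: u_def v_def w_def)
  obtain n\<^sub>1 m\<^sub>1 where L1: "norm n\<^sub>1 = 1" "L\<^sub>1 = {z. n\<^sub>1 \<bullet> z = m\<^sub>1}"
    using straight_line_hyperplane[OF assms(7)] by metis
  obtain n\<^sub>2 m\<^sub>2 where L2: "norm n\<^sub>2 = 1" "L\<^sub>2 = {z. n\<^sub>2 \<bullet> z = m\<^sub>2}"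
    using straight_line_hyperplane[OF assms(9)] by metis
  have ne: "n\<^sub>1 \<noteq> 0" "n\<^sub>2 \<noteq> 0"
    using L1(1) L2(1) by auto
  have nu: "n\<^sub>1 \<bullet> u t = m\<^sub>1" and nv: "n\<^sub>2 \<bullet> v t = m\<^sub>2" if "t \<in> I" for t
    using assms(8,10) that by (auto simp: L1(2) L2(2) u_def v_def)
  have nu': "n\<^sub>1 \<bullet> u' t = 0" if "t \<in> S" for t
    using S(2) that by (intro inner_local_max_derivative[OF du[OF that] S(1) that]) (simp add: nu subset_iff)
  have nv': "n\<^sub>2 \<bullet> v' t = 0" if "t \<in> S" for t
    using S(2) that by (intro inner_local_max_derivative[OF dv[OF that] S(1) that]) (simp add: nv subset_iff)
  have D: "det2 n\<^sub>1 n\<^sub>2 \<noteq> 0"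
  proof
    assume "det2 n\<^sub>1 n\<^sub>2 = 0"
    then obtain s where s: "n\<^sub>1 = s *\<^sub>R n\<^sub>2"
      using det2_eq_0_iff[OF ne(2)] by blast
    then have "s \<noteq> 0"
      using ne(1) by auto
    have nu2: "n\<^sub>2 \<bullet> u t = m\<^sub>1 / s" if "t \<in> I" for t
      using nu[OF that] \<open>s \<noteq> 0\<close> by (simp add: s field_simps)
    have nu2': "n\<^sub>2 \<bullet> u' t\<^sub>0 = 0"
      using nu'[OF t0] \<open>s \<noteq> 0\<close> by (simp add: s)
    have nw: "n\<^sub>2 \<bullet> w t = m\<^sub>1 / s + m\<^sub>2" if "t \<in> I" for t
      using w[OF that] nu2[OF that] nv[OF that] by (simp add: inner_add_right)
    have nw': "n\<^sub>2 \<bullet> w' t\<^sub>0 = 0"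
      using S(2) t0 by (intro inner_local_max_derivative[OF dw[OF t0] S(1) t0]) (simp add: nw subset_iff)
    have "t\<^sub>0 \<in> I"
      using t0 S(2) by blast
    have "closed K"
      using assms(1) unfolding centrally_symmetric_convex_disk_def by (blast intro: compact_imp_closed)
    then have inK: "u t\<^sub>0 \<in> K" "v t\<^sub>0 \<in> K" "w t\<^sub>0 \<in> K"
      using fr t0 frontier_subset_closed by blast+
    \<comment> \<open>With parallel lines, \<open>u\<close> and \<open>v\<close> are both tangent to
      the common direction at \<open>t\<^sub>0\<close>, so each of them confines \<open>K\<close> to
      a strip with normal \<open>n\<^sub>2\<close>.\<close>
    have "\<bar>n\<^sub>2 \<bullet> z\<bar> \<le> \<bar>m\<^sub>1 / s\<bar>" "\<bar>n\<^sub>2 \<bullet> z\<bar> \<le> \<bar>m\<^sub>2\<bar>" if "z \<in> K" for z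
      using symmetric_convex_disk_width[OF assms(1) du[OF t0] S(1) t0 fr(1) ru(1)[OF t0] ne(2) nu2' that]
        symmetric_convex_disk_width[OF assms(1) dv[OF t0] S(1) t0 fr(2) rv(1)[OF t0] ne(2) nv'[OF t0] that]
        nu2[OF \<open>t\<^sub>0 \<in> I\<close>] nv[OF \<open>t\<^sub>0 \<in> I\<close>] by auto
    from this(2)[OF inK(1)] this(1)[OF inK(2)] this(1)[OF inK(3)]
    have "\<bar>m\<^sub>1 / s\<bar> = \<bar>m\<^sub>2\<bar>" "\<bar>m\<^sub>1 / s + m\<^sub>2\<bar> \<le> \<bar>m\<^sub>1 / s\<bar>"
      using nu2[OF \<open>t\<^sub>0 \<in> I\<close>] nv[OF \<open>t\<^sub>0 \<in> I\<close>] nw[OF \<open>t\<^sub>0 \<in> I\<close>] by auto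
    \<comment> \<open>The two offsets agree up to sign. If they are equal, their sum is twice as
      large, so the bound at \<open>w\<close> forces them to vanish.\<close>
    then consider "m\<^sub>1 / s = 0" | "m\<^sub>1 / s + m\<^sub>2 = 0"
      by linarith
    then show False
    proof cases
      case 1
      \<comment> \<open>Here \<open>u\<close> moves along a line through the origin, against its
        positive angular velocity; the other case is the same for \<open>w\<close>.\<close>
      then have "det2 (u t\<^sub>0) (u' t\<^sub>0) = 0"
        using nu2[OF \<open>t\<^sub>0 \<in> I\<close>] nu2' ne(2) by (intro orthogonal_imp_det2_eq_0[of n\<^sub>2]) auto
      then show False
        using ru(2)[OF t0] by simp
    next
      case 2
      then have "det2 (w t\<^sub>0) (w' t\<^sub>0) = 0"
        using nw[OF \<open>t\<^sub>0 \<in> I\<close>] nw' ne(2) by (intro orthogonal_imp_det2_eq_0[of n\<^sub>2]) auto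
      then show False
        using rw(2)[OF t0] by simp
    qed
  qed
  define k where "k = m\<^sub>1 * m\<^sub>2 - det2 n\<^sub>1 n\<^sub>2 * (sqrt 3 / 2)"
  have k: "(n\<^sub>1 \<bullet> v t) * (n\<^sub>2 \<bullet> u t) = k" if "t \<in> I" for t
    using det2_mult_det2[of n\<^sub>1 n\<^sub>2 "u t" "v t"]
    unfolding uv[OF that] nu[OF that] nv[OF that] k_def by linarith
  have k0: "k \<noteq> 0"
  proof
    assume "k = 0"
    \<comment> \<open>Each velocity is nonzero and already orthogonal to one normal; orthogonality
      to the other would make the normals parallel.\<close>
    have nz: "n\<^sub>1 \<bullet> v' t \<noteq> 0" "n\<^sub>2 \<bullet> u' t \<noteq> 0" if "t \<in> S" for t
      using orthogonal_imp_det2_eq_0[of "v' t" n\<^sub>1 n\<^sub>2] orthogonal_imp_det2_eq_0[of "u' t" n\<^sub>1 n\<^sub>2]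
        D nu'[OF that] nv'[OF that] ru(1)[OF that] rv(1)[OF that] by (auto simp: inner_commute)
    have z: "n\<^sub>1 \<bullet> v t = 0" if t: "t \<in> S" for t
    proof (rule ccontr)
      assume ne: "n\<^sub>1 \<bullet> v t \<noteq> 0"
      \<comment> \<open>The product vanishes identically on \<open>S\<close>. Where its first factor
        is nonzero the second is zero, so the product rule leaves a single term with two nonzero
        factors.\<close>
      have "((\<lambda>s. (n\<^sub>1 \<bullet> v s) * (n\<^sub>2 \<bullet> u s)) has_real_derivative
          (n\<^sub>1 \<bullet> v' t) * (n\<^sub>2 \<bullet> u t) + (n\<^sub>2 \<bullet> u' t) * (n\<^sub>1 \<bullet> v t)) (at t)"
        by (intro DERIV_mult inner_has_real_derivative du dv t)
      then have "((\<lambda>s. 0) has_real_derivative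
          (n\<^sub>1 \<bullet> v' t) * (n\<^sub>2 \<bullet> u t) + (n\<^sub>2 \<bullet> u' t) * (n\<^sub>1 \<bullet> v t)) (at t)"
        using k S(2) \<open>k = 0\<close> by (elim has_field_derivative_transform_within_open[OF _ S(1) t]) auto
      then have "(n\<^sub>1 \<bullet> v' t) * (n\<^sub>2 \<bullet> u t) + (n\<^sub>2 \<bullet> u' t) * (n\<^sub>1 \<bullet> v t) = 0"
        using DERIV_const DERIV_unique by blast
      moreover have "n\<^sub>2 \<bullet> u t = 0"
        using k[of t] S(2) t \<open>k = 0\<close> ne by auto
      ultimately show False
        using nz[OF t] ne by simp
    qed
    then have "n\<^sub>1 \<bullet> v' t\<^sub>0 = 0"
      by (intro inner_local_max_derivative[OF dv[OF t0] S(1) t0]) (simp add: t0)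
    then show False
      using nz[OF t0] by simp
  qed
  define H where "H = {z. (n\<^sub>1 \<bullet> z - m\<^sub>1) * (n\<^sub>2 \<bullet> z - m\<^sub>2) = k}"
  \<comment> \<open>The equation is symmetric in the two lines, so \<open>asymptote_product\<close>
    can be applied to each of them.\<close>
  have H': "H = {z. (n\<^sub>2 \<bullet> z - m\<^sub>2) * (n\<^sub>1 \<bullet> z - m\<^sub>1) = k}"
    by (simp add: H_def mult.commute)
  have "hyperbolic_arc H (w ` I)"
    unfolding hyperbolic_arc_def
  proof (intro conjI)
    show "hyperbola H"
      unfolding H_def by (rule hyperbola_product[OF L1(1) L2(1) D k0])
    show "w ` I \<subseteq> H"
      using w nu nv k by (auto simp: H_def inner_add_right)
    have "continuous_on {0..t\<^sub>f} w"
      using assms(2) by (auto simp: C1_multi_curve_def C1_curve_def w_def differentiable_on_def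
          intro!: differentiable_imp_continuous_on)
    then show "connected (w ` I)"
      using assms(4,6) by (intro connected_continuous_image) (auto intro: continuous_on_subset is_interval_connected)
    show "\<exists>p\<in>w ` I. \<exists>q\<in>w ` I. p \<noteq> q"
    proof (rule ccontr)
      assume "\<not> ?thesis"
      then have "w t = w t\<^sub>0" if "t \<in> S" for t
        using S(2) that t0 by blast
      \<comment> \<open>Taking \<open>w' t\<^sub>0\<close> itself as the direction makes the
        derivative of the constant function equal to the squared speed.\<close>
      then have "w' t\<^sub>0 \<bullet> w' t\<^sub>0 = 0"
        by (intro inner_local_max_derivative[OF dw[OF t0] S(1) t0]) simp
      then show False
        using rw(1)[OF t0] by simp
    qed
  qed
  moreover have "L\<^sub>1 \<noteq> L\<^sub>2"
  proof -
    obtain e\<^sub>1 e\<^sub>2 where e: "n\<^sub>1 \<bullet> e\<^sub>1 = 1" "n\<^sub>2 \<bullet> e\<^sub>1 = 0" "n\<^sub>1 \<bullet> e\<^sub>2 = 0" "n\<^sub>2 \<bullet> e\<^sub>2 = 1"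
      using dual_basis2[OF D] by metis
    \<comment> \<open>The intersection point, shifted along the first line by
      \<open>e\<^sub>2\<close>, leaves the second.\<close>
    have "m\<^sub>1 *\<^sub>R e\<^sub>1 + (m\<^sub>2 + 1) *\<^sub>R e\<^sub>2 \<in> L\<^sub>1 - L\<^sub>2"
      by (simp add: L1(2) L2(2) inner_add_right e)
    then show ?thesis
      by blast
  qed
  moreover have "{L. asymptote H L} = {L\<^sub>1, L\<^sub>2}"
  proof -
    have "det2 n\<^sub>2 n\<^sub>1 \<noteq> 0"
      using D by (simp add: det2_eq algebra_simps)
    then have "asymptote H L\<^sub>1" "asymptote H L\<^sub>2"
      using asymptote_product[OF L1(1) L2(1) D, of m\<^sub>1 m\<^sub>2 k] asymptote_product[OF L2(1) L1(1), of m\<^sub>2 m\<^sub>1 k]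
      by (simp_all add: L1(2) L2(2) H_def flip: H'[unfolded H_def])
    moreover have "L = L\<^sub>1 \<or> L = L\<^sub>2" if "asymptote H L" for L
      using asymptote_product_cases[OF D k0 that[unfolded H_def]] by (simp add: L1(2) L2(2))
    ultimately show ?thesis
      by blast
  qed
  ultimately show ?thesis
    unfolding w_def by blast
qed

end
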